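(* Let $A$ be an $n\times n$ real constant matrix with $\mathrm{Re}(\sigma(A))<0$. Consider the time-changed system $$\mathrm{d}X(t)=AX(t)\,\mathrm{d}t+f(E_t,X(t))\,\mathrm{d}E_t,\qquad X(0)=x_0\in\mathbb{R}^n.$$ Suppose $f:\mathbb{R}^+\times\mathbb{R}^n\to\mathbb{R}^n$ is a nonlinear function which satisfies $$\|f(E_t,X(t))\|\le\|g(E_t)\|\,\|X(t)\|$$ with a function $g:\mathbb{R}^+\to\mathbb{R}^n$ satisfying $$\int_0^\infty\|g(s)\|\,\mathrm{d}s<\infty.$$ Then the trivial solution of the system is exponentially sample-path stable and, for every $p\ge1$, $p$th moment exponentially stable.
   Context: $U(t)$ is a $\beta$-stable subordinator, $\beta\in(0,1)$: a strictly increasing $\beta$-stable L\'evy process with $\mathbb{E}[\exp(-sU(t))]=\exp(-ts^\beta)$. Its inverse is $E_t=\inf\{s>0:U(s)>t\}$, a continuous nondecreasing process. The differential equation is understood in integral form, with pathwise Lebesgue--Stieltjes integrals with respect to $E_t$. $\sigma(A)$ is the spectrum of $A$, and $\mathrm{Re}(\sigma(A))<0$ means that every eigenvalue of $A$ has negative real part. $X(t)=X_t(x_0)$ denotes the solution with (deterministic) initial value $x_0$; it is assumed that the coefficients vanish at $x=0$ (so $f(E_t,0)=0$ for all $t\ge0$), whence $X\equiv0$ is the solution for $x_0=0$, called the trivial solution. Definitions. The trivial solution is: (1) exponentially sample-path stable if there are a function $\nu:[0,\infty)\to[0,\infty)$ with $\nu(t)\to\infty$ as $t\to\infty$ and positive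 constants $\lambda,K$ such that for every sample path (up to a null set) $\|X(t)\|\le K\|x_0\|\exp(-\lambda\nu(t))$ for all $t\ge0$ and arbitrary $x_0\in\mathbb{R}^n$; (2) $p$th moment exponentially stable if there are positive constants $\lambda,K$ such that $\mathbb{E}\|X_t(x_0)\|^p\le K\|x_0\|^p\exp(-\lambda t)$ for all $t\ge0$ and $x_0\in\mathbb{R}^n$. *)

theory Defs
  imports "HOL-Probability.Probability"
begin

text \<open>Stochastic processes are functions \<open>real \<Rightarrow> 'w \<Rightarrow> 'b\<close>; only times \<open>t \<ge> 0\<close> are relevant.\<close>

definition cadlag_path :: "(real \<Rightarrow> real) \<Rightarrow> bool" where
  "cadlag_path u \<longleftrightarrow>
     (\<forall>t\<ge>0. continuous (at_right t) u) \<and> (\<forall>t>0. \<exists>l. (u \<longlongrightarrow> l) (at_left t))"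

text \<open>Stochastic continuity is not listed: it follows from right-continuity at 0 together with
  stationarity of the increments.\<close>

definition levy_process :: "'w measure \<Rightarrow> (real \<Rightarrow> 'w \<Rightarrow> real) \<Rightarrow> bool" where
  "levy_process M U \<longleftrightarrow>
     (\<forall>t\<ge>0. U t \<in> borel_measurable M) \<and>
     (AE \<omega> in M. U 0 \<omega> = 0) \<and>
     (\<forall>(\<tau>::nat \<Rightarrow> real) k. 0 \<le> \<tau> 0 \<and> (\<forall>i<k. \<tau> i \<le> \<tau> (Suc i)) \<longrightarrow>
        prob_space.indep_vars M (\<lambda>_. borel) (\<lambda>i \<omega>. U (\<tau> (Suc i)) \<omega> - U (\<tau> i) \<omega>) {..<k}) \<and>
     (\<forall>s\<ge>0. \<forall>h\<ge>0. distr M borel (\<lambda>\<omega>. U (s + h) \<omega> - U s \<omega>) = distr M borel (U h)) \<and>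
     (AE \<omega> in M. cadlag_path (\<lambda>t. U t \<omega>))"

text \<open>The Laplace transform fixes the one-dimensional laws to be the \<open>\<beta>\<close>-stable ones, with the
  usual normalisation.\<close>

definition stable_subordinator :: "'w measure \<Rightarrow> real \<Rightarrow> (real \<Rightarrow> 'w \<Rightarrow> real) \<Rightarrow> bool" where
  "stable_subordinator M \<beta> U \<longleftrightarrow>
     levy_process M U \<and>
     (AE \<omega> in M. strict_mono_on {0..} (\<lambda>t. U t \<omega>)) \<and>
     (\<forall>t\<ge>0. \<forall>s\<ge>0. (LINT \<omega>|M. exp (- s * U t \<omega>)) = exp (- t * s powr \<beta>))"

definition inverse_process :: "(real \<Rightarrow> 'w \<Rightarrow> real) \<Rightarrow> real \<Rightarrow> 'w \<Rightarrow> real" where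
  "inverse_process U t \<omega> = Inf {s. s > 0 \<and> U s \<omega> > t}"

text \<open>The Stieltjes measure of a path on \<open>[0,\<infinity>)\<close>: \<open>interval_measure\<close> expects a function on the
  whole line, so the path is continued to the left by its value at 0, which puts no mass on
  \<open>(-\<infinity>,0]\<close>. \<open>interval_measure\<close> is meaningful only for nondecreasing right-continuous functions;
  almost every path of the inverse of a stable subordinator is one.\<close>

definition path_measure :: "(real \<Rightarrow> real) \<Rightarrow> real measure" where
  "path_measure e = interval_measure (\<lambda>t. e (max 0 t))"

text \<open>A path \<open>x\<close> solves \<open>dx(t) = A x(t) dt + f(e(t), x(t)) de(t)\<close>, \<open>x(0) = x0\<close>, in integral form.\<close>

definition path_solution ::
  "real^'n^'n \<Rightarrow> (real \<Rightarrow> real^'n \<Rightarrow> real^'n) \<Rightarrow> (real \<Rightarrow> real) \<Rightarrow> real^'n \<Rightarrow> (real \<Rightarrow> real^'n) \<Rightarrow> bool"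
  where
  "path_solution A f e x0 x \<longleftrightarrow>
     (\<forall>t\<ge>0. set_integrable lborel {0..t} (\<lambda>s. A *v x s) \<and>
            set_integrable (path_measure e) {0..t} (\<lambda>s. f (e s) (x s)) \<and>
            x t = x0 + (LINT s:{0..t}|lborel. A *v x s)
                     + (LINT s:{0..t}|path_measure e. f (e s) (x s)))"

text \<open>\<open>X x0 t\<close> stands for \<open>X\<^sub>t(x0)\<close>. As the equation is a pathwise one, the exceptional
  null set does not depend on the initial value.\<close>

definition solution_family ::
  "'w measure \<Rightarrow> real^'n^'n \<Rightarrow> (real \<Rightarrow> real^'n \<Rightarrow> real^'n) \<Rightarrow> (real \<Rightarrow> 'w \<Rightarrow> real) \<Rightarrow>
   (real^'n \<Rightarrow> real \<Rightarrow> 'w \<Rightarrow> real^'n) \<Rightarrow> bool"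
  where
  "solution_family M A f E X \<longleftrightarrow>
     (\<forall>x0. \<forall>t\<ge>0. X x0 t \<in> borel_measurable M) \<and>
     (AE \<omega> in M. \<forall>x0. path_solution A f (\<lambda>t. E t \<omega>) x0 (\<lambda>t. X x0 t \<omega>))"

text \<open>Complex eigenvalues of a real matrix, with complex eigenvectors.\<close>

definition matrix_spectrum :: "real^'n^'n \<Rightarrow> complex set" where
  "matrix_spectrum A =
     {z. \<exists>v::complex^'n. v \<noteq> 0 \<and> (\<chi> i j. complex_of_real (A $ i $ j)) *v v = z *s v}"

definition exp_sample_path_stable ::
  "'w measure \<Rightarrow> (real^'n \<Rightarrow> real \<Rightarrow> 'w \<Rightarrow> real^'n) \<Rightarrow> bool" where
  "exp_sample_path_stable M X \<longleftrightarrow>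
     (\<exists>(\<nu>::real \<Rightarrow> real) l K. (\<forall>t\<ge>0. 0 \<le> \<nu> t) \<and> filterlim \<nu> at_top at_top \<and> 0 < l \<and> 0 < K \<and>
        (AE \<omega> in M. \<forall>t\<ge>0. \<forall>x0. norm (X x0 t \<omega>) \<le> K * norm x0 * exp (- l * \<nu> t)))"

definition moment_exp_stable ::
  "'w measure \<Rightarrow> real \<Rightarrow> (real^'n \<Rightarrow> real \<Rightarrow> 'w \<Rightarrow> real^'n) \<Rightarrow> bool" where
  "moment_exp_stable M p X \<longleftrightarrow>
     (\<exists>l K. 0 < l \<and> 0 < K \<and>
        (\<forall>t\<ge>0. \<forall>x0. integrable M (\<lambda>\<omega>. norm (X x0 t \<omega>) powr p) \<and>
           (LINT \<omega>|M. norm (X x0 t \<omega>) powr p) \<le> K * norm x0 powr p * exp (- l * t)))"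

end

theory Submission
  imports Defs "HOL-Computational_Algebra.Fundamental_Theorem_Algebra" "HOL-Real_Asymp.Real_Asymp"
begin

text \<open>
  Almost every path of \<open>E\<close> is a continuous, nondecreasing, unbounded time change starting at 0, and
  on such a path the claim is deterministic: it even holds with \<open>\<nu> t = t\<close> and constants that do not
  depend on the path, so the moment bound follows by integrating the \<open>p\<close>th power of the path bound.

  Along one path \<open>e\<close>, the linear part contracts at a rate \<open>l > 0\<close> and the nonlinear part can only
  multiply the size of the solution by \<open>exp (C * \<integral> \<parallel>g (e s)\<parallel> de(s))\<close>. The substitution \<open>v = e s\<close>
  (lemma \<open>distr_path_measure\<close>: the Stieltjes measure of \<open>e\<close> is carried by \<open>e\<close> to Lebesgue measure
  on the half-line) bounds that exponent by \<open>C * \<integral>\<^sub>0\<^sup>\<infinity> \<parallel>g v\<parallel> dv\<close>, for every path.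

  The contraction is expressed without matrix exponentials. A Hurwitz matrix has a norm \<open>N\<close>,
  equivalent to the Euclidean one, in which every short Euler step contracts:
  \<open>N (v + h *\<^sub>R (A *v v)) \<le> (1 - l * h) * N v\<close> (lemma \<open>hurwitz_adapted_norm\<close>). Over a short interval
  \<open>[s, t]\<close> the solution is an Euler step from \<open>x s\<close> plus the Stieltjes integral of the nonlinearity,
  up to an error that is small compared with the interval because \<open>x\<close> is continuous. Hence
  \<open>exp (l * t - G t) * N (x t)\<close>, where \<open>G\<close> is \<open>C\<close> times the integral of \<open>\<parallel>g \<circ> e\<parallel>\<close> against \<open>de\<close>,
  grows by at most an arbitrarily small multiple of the increment of \<open>t + G t\<close>; summing over a fine
  partition (lemma \<open>le_of_infinitesimal_growth\<close>) shows that it does not grow at all. This argument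
  takes the place of variation of constants and of a Gronwall inequality for Stieltjes integrals.
\<close>

section \<open>A norm adapted to a Hurwitz matrix\<close>

text \<open>The product of the operators \<open>B - z\<close> over the list, which is easier to handle than a matrix
  product because the induction over the list moves through vectors.\<close>

fun shift_prod :: "complex^'n^'n \<Rightarrow> complex list \<Rightarrow> complex^'n \<Rightarrow> complex^'n" where
  "shift_prod B [] v = v"
| "shift_prod B (z # zs) v = shift_prod B zs (B *v v - z *s v)"

lemma shift_prod_commute:
  "shift_prod B zs (B *v v - z *s v) = B *v shift_prod B zs v - z *s shift_prod B zs v"
proof (induction zs arbitrary: v)
  case (Cons y zs)
  have "B *v (B *v v - z *s v) - y *s (B *v v - z *s v)
      = B *v (B *v v - y *s v) - z *s (B *v v - y *s v)"
    by (simp add: matrix_vector_mult_diff_distrib vector_scalar_commute vector_ssub_ldistrib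
        vector_smult_assoc mult.commute)
  then have "shift_prod B (y # zs) (B *v v - z *s v)
      = shift_prod B zs (B *v (B *v v - y *s v) - z *s (B *v v - y *s v))"
    by (simp only: shift_prod.simps)
  also have "\<dots> = B *v shift_prod B (y # zs) v - z *s shift_prod B (y # zs) v"
    by (simp only: Cons.IH shift_prod.simps)
  finally show ?case .
qed simp

lemma shift_prod_append: "shift_prod B (ys @ zs) v = shift_prod B zs (shift_prod B ys v)"
  by (induction ys arbitrary: v) auto

text \<open>The vector \<open>p(B) v\<close>.\<close>

definition poly_act :: "complex^'n^'n \<Rightarrow> complex poly \<Rightarrow> complex^'n \<Rightarrow> complex^'n" where
  "poly_act B p v = (\<Sum>i\<le>degree p. coeff p i *s (((*v) B ^^ i) v))"

lemma poly_act_altdef: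
  assumes "degree p \<le> N"
  shows "poly_act B p v = (\<Sum>i\<le>N. coeff p i *s (((*v) B ^^ i) v))"
  unfolding poly_act_def
  by (rule sum.mono_neutral_left) (use assms in \<open>auto simp: coeff_eq_0\<close>)

lemma poly_act_linear_factor:
  "poly_act B ([:-z, 1:] * q) v = poly_act B q (B *v v - z *s v)"
proof -
  define N where "N = degree q"
  have it_add: "((*v) B ^^ i) (a - c *s b) = ((*v) B ^^ i) a - c *s ((*v) B ^^ i) b" for i a b c
    by (induction i) (simp_all add: matrix_vector_mult_diff_distrib vector_scalar_commute)
  have "degree ([:-z, 1:] * q) \<le> Suc N"
    unfolding N_def using degree_mult_le[of "[:-z, 1:]" q] by simp
  then have "poly_act B ([:-z, 1:] * q) v
      = (\<Sum>i\<le>Suc N. coeff ([:-z, 1:] * q) i *s (((*v) B ^^ i) v))"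
    by (rule poly_act_altdef)
  also have "\<dots> = (\<Sum>i\<le>Suc N. (- z * coeff q i) *s (((*v) B ^^ i) v))
      + (\<Sum>i\<le>Suc N. (case i of 0 \<Rightarrow> 0 | Suc j \<Rightarrow> coeff q j) *s (((*v) B ^^ i) v))"
    by (simp add: coeff_pCons vector_sadd_rdistrib sum.distrib
             flip: sum.distrib del: sum.atMost_Suc split: nat.splits)
  also have "(\<Sum>i\<le>Suc N. (- z * coeff q i) *s (((*v) B ^^ i) v))
      = (\<Sum>i\<le>N. (- z * coeff q i) *s (((*v) B ^^ i) v))"
    by (simp add: N_def coeff_eq_0)
  also have "(\<Sum>i\<le>Suc N. (case i of 0 \<Rightarrow> 0 | Suc j \<Rightarrow> coeff q j) *s (((*v) B ^^ i) v))
      = (\<Sum>i\<le>N. coeff q i *s (((*v) B ^^ i) (B *v v)))"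
    by (simp add: sum.atMost_Suc_shift funpow_swap1 del: sum.atMost_Suc)
  also have "(\<Sum>i\<le>N. (- z * coeff q i) *s (((*v) B ^^ i) v)) + \<dots>
      = (\<Sum>i\<le>N. coeff q i *s (((*v) B ^^ i) (B *v v - z *s v)))"
    unfolding sum.distrib[symmetric]
    by (intro sum.cong refl)
       (simp add: it_add vector_ssub_ldistrib vector_smult_assoc vector_smult_lneg mult.commute)
  also have "\<dots> = poly_act B q (B *v v - z *s v)"
    by (simp add: poly_act_def N_def)
  finally show ?thesis .
qed

text \<open>The fundamental theorem of algebra splits off one root at a time; the leading coefficient is
  nonzero and so does not affect vanishing.\<close>

lemma poly_act_imp_shift_prod:
  assumes "p \<noteq> 0"
  shows "\<exists>zs. \<forall>v. poly_act B p v = 0 \<longrightarrow> shift_prod B zs v = 0"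
  using assms
proof (induction "degree p" arbitrary: p)
  case 0
  then obtain c where "p = [:c:]" "c \<noteq> 0"
    by (metis degree_eq_zeroE pCons_0_0)
  then have "\<forall>v. poly_act B p v = 0 \<longrightarrow> shift_prod B [] v = 0"
    by (simp add: poly_act_def)
  then show ?case by blast
next
  case (Suc d)
  then have "\<not> constant (poly p)" by (simp add: constant_degree)
  then obtain z where "poly p z = 0" using fundamental_theorem_of_algebra by blast
  then obtain q where q: "p = [:-z, 1:] * q" by (metis dvdE poly_eq_0_iff_dvd)
  with Suc.prems have "q \<noteq> 0" by auto
  then have "degree p = Suc (degree q)" unfolding q by (subst degree_mult_eq) auto
  with Suc.hyps \<open>q \<noteq> 0\<close> obtain zs where
    zs: "\<And>v. poly_act B q v = 0 \<Longrightarrow> shift_prod B zs v = 0"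
    by (metis nat.inject)
  then have "\<forall>v. poly_act B p v = 0 \<longrightarrow> shift_prod B (z # zs) v = 0"
    by (simp add: q poly_act_linear_factor del: mult_pCons_left)
  then show ?case by blast
qed

text \<open>A family, unlike a set, may repeat a vector, and a repetition is a relation by itself.\<close>

lemma nontrivial_relation:
  fixes P :: "nat \<Rightarrow> 'a::euclidean_space"
  obtains c k where "k \<le> DIM('a)" "c k \<noteq> (0::real)" "(\<Sum>i\<le>DIM('a). c i *\<^sub>R P i) = 0"
proof (cases "inj_on P {..DIM('a)}")
  case True
  then have "card (P ` {..DIM('a)}) = Suc DIM('a)" by (simp add: card_image)
  then have "dependent (P ` {..DIM('a)})" by (intro dependent_biggerset) simp
  then obtain u w where "w \<in> P ` {..DIM('a)}" "u w \<noteq> 0" "(\<Sum>w\<in>P ` {..DIM('a)}. u w *\<^sub>R w) = 0"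
    by (subst (asm) dependent_finite) auto
  then show ?thesis
    using that[of _ "\<lambda>i. u (P i)"] True by (auto simp: sum.reindex)
next
  case False
  then obtain i j where ij: "i \<le> DIM('a)" "j \<le> DIM('a)" "i \<noteq> j" "P i = P j"
    by (auto simp: inj_on_def)
  define c :: "nat \<Rightarrow> real" where "c = (\<lambda>k. if k = i then 1 else if k = j then -1 else 0)"
  have "c k *\<^sub>R P k = (if k = i then P i else 0) - (if k = j then P j else 0)" for k
    using ij by (auto simp: c_def)
  then have "(\<Sum>k\<le>DIM('a). c k *\<^sub>R P k) = 0"
    using ij by (simp add: sum_subtractf)
  with ij that[of i c] show ?thesis by (simp add: c_def)
qed

lemma scaleR_eq_of_real_smult: "r *\<^sub>R v = complex_of_real r *s v"
  by (simp add: vec_eq_iff complex_eq_iff)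

text \<open>Applied to the powers of \<open>B\<close>, a relation gives a nonzero polynomial that annihilates \<open>B\<close>.\<close>

lemma exists_annihilating_list:
  fixes B :: "complex^'n^'n"
  obtains zs where "\<And>v. shift_prod B zs v = 0"
proof -
  define P where "P i = ((**) B ^^ i) (mat 1)" for i
  have P: "P i *v v = ((*v) B ^^ i) v" for i v
    by (induction i) (simp_all add: P_def flip: matrix_vector_mul_assoc)
  obtain c k where k: "k \<le> DIM(complex^'n^'n)" "c k \<noteq> 0"
    and c: "(\<Sum>i\<le>DIM(complex^'n^'n). c i *\<^sub>R P i) = 0"
    by (rule nontrivial_relation[of P])
  define N where "N = DIM(complex^'n^'n)"
  define p where "p = (\<Sum>i\<le>N. monom (complex_of_real (c i)) i)"
  have cf: "coeff p j = (if j \<le> N then complex_of_real (c j) else 0)" for j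
    by (simp add: p_def coeff_sum)
  have "p \<noteq> 0"
  proof
    assume "p = 0"
    with cf[of k] k show False by (simp add: N_def)
  qed
  have deg: "degree p \<le> N" by (rule degree_le) (simp add: cf)
  have "poly_act B p v = 0" for v
  proof -
    have "poly_act B p v = (\<Sum>i\<le>N. c i *\<^sub>R (P i *v v))"
      unfolding poly_act_altdef[OF deg] by (simp add: cf P scaleR_eq_of_real_smult)
    also have "\<dots> = (\<Sum>i\<le>N. c i *\<^sub>R P i) *v v"
      by (induction N, simp_all add: matrix_vector_mult_add_rdistrib, simp_all add: matrix_vector_mult_def
        vec_eq_iff scaleR_sum_right)
    finally show ?thesis using c by (simp add: N_def)
  qed
  with poly_act_imp_shift_prod[OF \<open>p \<noteq> 0\<close>, of B] that show ?thesis by auto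
qed

text \<open>A shortest annihilating list consists of eigenvalues: if \<open>z\<close> is removed, the remaining product
  has a nonzero value, and the factor \<open>B - z\<close>, which commutes with the others, sends it to 0.\<close>

lemma exists_annihilating_eigenvalue_list:
  fixes B :: "complex^'n^'n"
  obtains zs where "\<And>v. shift_prod B zs v = 0"
    and "\<And>z. z \<in> set zs \<Longrightarrow> \<exists>v. v \<noteq> 0 \<and> B *v v = z *s v"
proof -
  have "\<exists>zs. \<forall>v. shift_prod B zs v = 0" by (meson exists_annihilating_list)
  then obtain zs where zs: "\<forall>v. shift_prod B zs v = 0"
    and min: "\<And>ys. \<forall>v. shift_prod B ys v = 0 \<Longrightarrow> length zs \<le> length ys"
    using ex_has_least_nat[of "\<lambda>zs. \<forall>v. shift_prod B zs v = 0" _ length] by blast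
  have "\<exists>v. v \<noteq> 0 \<and> B *v v = z *s v" if "z \<in> set zs" for z
  proof -
    obtain xs ys where eq: "zs = xs @ z # ys" using split_list[OF \<open>z \<in> set zs\<close>] by blast
    with min[of "xs @ ys"] obtain v where v: "shift_prod B (xs @ ys) v \<noteq> 0" by auto
    have "B *v shift_prod B (xs @ ys) v - z *s shift_prod B (xs @ ys) v = shift_prod B zs v"
      by (simp add: eq shift_prod_append shift_prod_commute)
    with zs v show ?thesis by auto
  qed
  with zs that show ?thesis by blast
qed

text \<open>For \<open>zs = [z\<^sub>1, \<dots>, z\<^sub>m]\<close> this is the sum of \<open>c\<^sup>k \<parallel>(B - z\<^sub>k) \<dots> (B - z\<^sub>1) v\<parallel>\<close> over \<open>k \<le> m\<close>. The
  vectors in the sum form a chain on which \<open>B\<close> is bidiagonal with diagonal \<open>zs\<close>, and a large weight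
  \<open>c\<close> makes the off-diagonal entries small.\<close>

fun chain_norm :: "complex^'n^'n \<Rightarrow> real \<Rightarrow> complex list \<Rightarrow> complex^'n \<Rightarrow> real" where
  "chain_norm B c [] v = norm v"
| "chain_norm B c (z # zs) v = norm v + c * chain_norm B c zs (B *v v - z *s v)"

lemma norm_complex_smult: "norm (c *s v) = cmod c * norm (v :: complex^'n)"
  by (simp add: norm_vec_def L2_set_def norm_mult power_mult_distrib real_sqrt_mult
      flip: sum_distrib_left)

lemma chain_norm_ge:
  assumes "0 \<le> c"
  shows "norm v \<le> chain_norm B c zs v"
proof (induction zs arbitrary: v)
  case (Cons z zs)
  have "0 \<le> chain_norm B c zs (B *v v - z *s v)" by (rule order_trans[OF norm_ge_zero Cons.IH])
  with assms show ?case by simp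
qed simp

lemma chain_norm_triangle:
  assumes "0 \<le> c"
  shows "chain_norm B c zs (u + v) \<le> chain_norm B c zs u + chain_norm B c zs v"
proof (induction zs arbitrary: u v)
  case (Cons z zs)
  have "B *v (u + v) - z *s (u + v) = (B *v u - z *s u) + (B *v v - z *s v)"
    by (simp add: matrix_vector_right_distrib vector_add_ldistrib)
  then have "chain_norm B c (z # zs) (u + v)
      = norm (u + v) + c * chain_norm B c zs ((B *v u - z *s u) + (B *v v - z *s v))"
    by (simp only: chain_norm.simps)
  also have "\<dots> \<le> (norm u + norm v)
      + c * (chain_norm B c zs (B *v u - z *s u) + chain_norm B c zs (B *v v - z *s v))"
    by (intro add_mono mult_left_mono norm_triangle_ineq Cons.IH assms)
  finally show ?case by (simp add: distrib_left)
qed (simp add: norm_triangle_ineq)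

lemma chain_norm_le:
  assumes "0 \<le> c"
  shows "\<exists>C>0. \<forall>v. chain_norm B c zs v \<le> C * norm v"
proof (induction zs)
  case Nil
  show ?case by (auto intro: exI[of _ 1])
next
  case (Cons z zs)
  then obtain C where C: "C > 0" "\<And>v. chain_norm B c zs v \<le> C * norm v" by blast
  have "linear (\<lambda>v. B *v v - z *s v)"
    by (intro linearI)
       (simp_all add: matrix_vector_right_distrib vector_add_ldistrib matrix_vector_mult_scaleR
         scaleR_eq_of_real_smult vector_scalar_commute vector_ssub_ldistrib vector_smult_assoc
         mult.commute)
  then obtain D where D: "D > 0" "\<And>v. norm (B *v v - z *s v) \<le> D * norm v"
    using linear_bounded_pos by blast
  have "chain_norm B c (z # zs) v \<le> (1 + c * (C * D)) * norm v" for v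
  proof -
    have "chain_norm B c zs (B *v v - z *s v) \<le> C * (D * norm v)"
      using C D by (meson mult_left_mono less_imp_le order_trans)
    then have "c * chain_norm B c zs (B *v v - z *s v) \<le> c * (C * (D * norm v))"
      using assms by (rule mult_left_mono)
    then show ?thesis by (simp add: algebra_simps)
  qed
  moreover have "1 + c * (C * D) > 0" using assms C D by (simp add: add_pos_nonneg)
  ultimately show ?case by blast
qed

text \<open>With \<open>w = B v - z v\<close>, the Euler step is \<open>(1 + h z) v + h w\<close>. The extra term \<open>h \<parallel>w\<parallel>\<close> is paid by
  the next entry of the chain, where \<open>\<parallel>w\<parallel>\<close> occurs with the weight \<open>c\<close>. Subtracting \<open>norm v\<close> in the
  last summand, since nothing has to be paid for the first entry, makes the induction close without
  loss. The annihilation hypothesis says that the chain ends in 0.\<close>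

lemma chain_norm_euler_step:
  assumes c: "0 < c" and h: "0 \<le> h"
    and zs: "\<And>z. z \<in> set zs \<Longrightarrow> cmod (1 + complex_of_real h * z) \<le> q"
    and "shift_prod B zs v = 0"
  shows "chain_norm B c zs (v + h *\<^sub>R (B *v v))
       \<le> q * chain_norm B c zs v + h / c * (chain_norm B c zs v - norm v)"
  using zs assms(4)
proof (induction zs arbitrary: v)
  case (Cons z zs)
  define w where "w = B *v v - z *s v"
  have "v + h *\<^sub>R (B *v v) = (1 + complex_of_real h * z) *s v + h *\<^sub>R w"
    by (simp add: w_def scaleR_eq_of_real_smult vector_ssub_ldistrib vector_sadd_rdistrib
        vector_smult_assoc)
  then have "norm (v + h *\<^sub>R (B *v v)) \<le> cmod (1 + complex_of_real h * z) * norm v + h * norm w"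
    using norm_triangle_ineq[of "(1 + complex_of_real h * z) *s v" "h *\<^sub>R w"] h
    by (simp only: norm_complex_smult norm_scaleR abs_of_nonneg)
  also have "\<dots> \<le> q * norm v + h * norm w"
    using Cons.prems(1)[of z] by (simp add: mult_right_mono)
  finally have 1: "norm (v + h *\<^sub>R (B *v v)) \<le> q * norm v + h * norm w" .
  have "B *v (v + h *\<^sub>R (B *v v)) - z *s (v + h *\<^sub>R (B *v v)) = w + h *\<^sub>R (B *v w)"
    by (simp add: w_def scaleR_eq_of_real_smult matrix_vector_right_distrib
        matrix_vector_mult_diff_distrib vector_scalar_commute vector_ssub_ldistrib
        vector_add_ldistrib vector_smult_assoc mult.commute)
  then have "chain_norm B c (z # zs) (v + h *\<^sub>R (B *v v))
      = norm (v + h *\<^sub>R (B *v v)) + c * chain_norm B c zs (w + h *\<^sub>R (B *v w))"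
    by simp
  also have "\<dots> \<le> (q * norm v + h * norm w)
      + c * (q * chain_norm B c zs w + h / c * (chain_norm B c zs w - norm w))"
    using 1 Cons.IH[of w] Cons.prems c by (intro add_mono mult_left_mono) (auto simp: w_def)
  also have "\<dots> = q * chain_norm B c (z # zs) v
      + h / c * (chain_norm B c (z # zs) v - norm v)"
    using c by (simp add: w_def[symmetric] field_simps)
  finally show ?case .
qed simp

text \<open>To first order in \<open>h\<close>, the modulus is \<open>1 + h * Re z\<close>; half of this rate absorbs the quadratic term
  as long as \<open>h \<le> - Re z / \<bar>z\<bar>\<^sup>2\<close>.\<close>

lemma euler_factor_bound:
  assumes "Re z < 0"
  shows "\<exists>l>0. \<exists>h0>0. \<forall>h. 0 \<le> h \<and> h \<le> h0 \<longrightarrow> cmod (1 + complex_of_real h * z) \<le> 1 - l * h"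
proof -
  have nz: "cmod z > 0" using assms by auto
  define a where "a = - Re z"
  have a: "0 < a" "a \<le> cmod z" using assms abs_Re_le_cmod[of z] by (auto simp: a_def)
  have "cmod (1 + complex_of_real h * z) \<le> 1 - a / 2 * h"
    if h: "0 \<le> h" "h \<le> a / (cmod z)\<^sup>2" for h
  proof (rule power2_le_imp_le)
    have hz: "h * (cmod z)\<^sup>2 \<le> a" using h nz by (simp add: field_simps)
    have "(cmod (1 + complex_of_real h * z))\<^sup>2 = 1 - 2 * h * a + h * (h * (cmod z)\<^sup>2)"
      unfolding cmod_power2 by (simp add: a_def algebra_simps power2_eq_square)
    also have "\<dots> \<le> 1 - 2 * h * a + h * a"
      using mult_left_mono[OF hz h(1)] by (simp add: mult.commute)
    also have "\<dots> \<le> (1 - a / 2 * h)\<^sup>2"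
      using a h(1) by (simp add: power2_eq_square algebra_simps)
    finally show "(cmod (1 + complex_of_real h * z))\<^sup>2 \<le> (1 - a / 2 * h)\<^sup>2" .
    have "a * (h * a) \<le> a * 1"
    proof -
      have "h * a\<^sup>2 \<le> h * (cmod z)\<^sup>2" using a h by (intro mult_left_mono power_mono) auto
      with hz show ?thesis by (simp add: power2_eq_square algebra_simps)
    qed
    then have "h * a \<le> 1" using a(1) mult_le_cancel_left_pos by blast
    then show "0 \<le> 1 - a / 2 * h" by (simp add: algebra_simps)
  qed
  moreover have "a / 2 > 0" "a / (cmod z)\<^sup>2 > 0" using a nz by simp_all
  ultimately show ?thesis by blast
qed

lemma euler_factor_bound_list:
  assumes "\<And>z. z \<in> set zs \<Longrightarrow> Re z < 0"
  shows "\<exists>l>0. \<exists>h0>0. \<forall>z\<in>set zs. \<forall>h. 0 \<le> h \<and> h \<le> h0 \<longrightarrow>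
           cmod (1 + complex_of_real h * z) \<le> 1 - l * h"
  using assms
proof (induction zs)
  case Nil
  show ?case by (auto intro: exI[of _ "1::real"])
next
  case (Cons z zs)
  then obtain l h0 where 1: "l > 0" "h0 > 0"
    "\<And>z h. z \<in> set zs \<Longrightarrow> 0 \<le> h \<Longrightarrow> h \<le> h0 \<Longrightarrow> cmod (1 + complex_of_real h * z) \<le> 1 - l * h"
    by (metis list.set_intros(2))
  obtain l' h0' where 2: "l' > 0" "h0' > 0"
    "\<And>h. 0 \<le> h \<Longrightarrow> h \<le> h0' \<Longrightarrow> cmod (1 + complex_of_real h * z) \<le> 1 - l' * h"
    using euler_factor_bound[of z] Cons.prems by (metis list.set_intros(1))
  have "cmod (1 + complex_of_real h * y) \<le> 1 - min l l' * h"
    if "y \<in> set (z # zs)" "0 \<le> h" "h \<le> min h0 h0'" for y h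
  proof -
    have "min l l' * h \<le> l * h" "min l l' * h \<le> l' * h" using that by (auto intro: mult_right_mono)
    with that 1(3)[of y h] 2(3)[of h] show ?thesis by auto
  qed
  moreover have "min l l' > 0" "min h0 h0' > 0" using 1 2 by auto
  ultimately show ?case by blast
qed

text \<open>The eigenvalues and the chain live in complex space; the norm is pulled back along the embedding
  of real vectors.\<close>

lemma hurwitz_adapted_norm:
  fixes A :: "real^'n^'n"
  assumes "\<forall>z\<in>matrix_spectrum A. Re z < 0"
  obtains N :: "real^'n \<Rightarrow> real" and l h0 C where "0 < l" "0 < h0" "0 < C"
    and "\<And>v. norm v \<le> N v" and "\<And>v. N v \<le> C * norm v" and "\<And>u v. N (u + v) \<le> N u + N v"
    and "\<And>h v. 0 \<le> h \<Longrightarrow> h \<le> h0 \<Longrightarrow> N (v + h *\<^sub>R (A *v v)) \<le> (1 - l * h) * N v"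
proof -
  define B :: "complex^'n^'n" where "B = (\<chi> i j. complex_of_real (A $ i $ j))"
  define \<iota> :: "real^'n \<Rightarrow> complex^'n" where "\<iota> v = (\<chi> i. complex_of_real (v $ i))" for v
  have B_\<iota>: "\<iota> (A *v v) = B *v \<iota> v" for v
    by (simp add: \<iota>_def B_def vec_eq_iff matrix_vector_mult_def)
  have norm_\<iota>: "norm (\<iota> v) = norm v" for v
    by (simp add: \<iota>_def norm_vec_def)
  have \<iota>_add: "\<iota> (u + v) = \<iota> u + \<iota> v" and \<iota>_scale: "\<iota> (r *\<^sub>R v) = r *\<^sub>R \<iota> v" for u v r
    by (simp_all add: \<iota>_def vec_eq_iff complex_eq_iff)
  obtain zs where zs: "\<And>v. shift_prod B zs v = 0"
    and ev: "\<And>z. z \<in> set zs \<Longrightarrow> \<exists>v. v \<noteq> 0 \<and> B *v v = z *s v"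
    by (rule exists_annihilating_eigenvalue_list[of B]) blast
  have "Re z < 0" if "z \<in> set zs" for z
    using assms ev[OF that] unfolding matrix_spectrum_def B_def by blast
  then obtain l h0 where l: "l > 0" and h0: "h0 > 0"
    and fac: "\<And>z h. z \<in> set zs \<Longrightarrow> 0 \<le> h \<Longrightarrow> h \<le> h0 \<Longrightarrow>
                cmod (1 + complex_of_real h * z) \<le> 1 - l * h"
    using euler_factor_bound_list[of zs] by blast
  \<comment> \<open>With this weight the coupling term \<open>h / c\<close> uses up half of the rate \<open>l\<close>.\<close>
  define c where "c = 2 / l"
  have c: "c > 0" using l by (simp add: c_def)
  obtain C where C: "C > 0" "\<And>v. chain_norm B c zs v \<le> C * norm v"
    using chain_norm_le[of c B zs] c by auto
  define N where "N v = chain_norm B c zs (\<iota> v)" for v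
  show ?thesis
  proof (rule that[of "l / 2" h0 C N])
    show "0 < l / 2" "0 < h0" "0 < C" using l h0 C by auto
    show "norm v \<le> N v" for v
      using chain_norm_ge[of c "\<iota> v" B zs] c by (simp add: N_def norm_\<iota>)
    show "N v \<le> C * norm v" for v
      using C(2)[of "\<iota> v"] by (simp add: N_def norm_\<iota>)
    show "N (u + v) \<le> N u + N v" for u v
      using chain_norm_triangle[of c B zs] c by (simp add: N_def \<iota>_add)
    show "N (v + h *\<^sub>R (A *v v)) \<le> (1 - l / 2 * h) * N v" if h: "0 \<le> h" "h \<le> h0" for h v
    proof -
      have "N (v + h *\<^sub>R (A *v v)) \<le> (1 - l * h) * N v + h / c * (N v - norm (\<iota> v))"
        unfolding N_def \<iota>_add \<iota>_scale B_\<iota>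
        by (rule chain_norm_euler_step) (use c h fac zs in auto)
      also have "\<dots> \<le> (1 - l * h) * N v + h / c * N v"
        using c h by (intro add_left_mono mult_left_mono) auto
      also have "\<dots> = (1 - l / 2 * h) * N v"
        using l by (simp add: c_def algebra_simps)
      finally show ?thesis .
    qed
  qed
qed

section \<open>Comparison of infinitesimal increments\<close>

text \<open>Over \<open>n\<close> equal steps with \<open>T / n < \<delta>\<close> the increments of \<open>H\<close> telescope, so the total growth of
  \<open>w\<close> is at most \<open>\<epsilon> * (H T - H 0)\<close>.\<close>

lemma le_of_infinitesimal_growth:
  fixes w H :: "real \<Rightarrow> real"
  assumes "0 \<le> T"
    and growth: "\<And>\<epsilon>. 0 < \<epsilon> \<Longrightarrow> \<exists>\<delta>>0. \<forall>s t. 0 \<le> s \<and> s \<le> t \<and> t \<le> T \<and> t - s < \<delta> \<longrightarrow>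
                   w t - w s \<le> \<epsilon> * (H t - H s)"
  shows "w T \<le> w 0"
proof -
  have eps: "w T - w 0 \<le> \<epsilon> * (H T - H 0)" if \<epsilon>: "0 < \<epsilon>" for \<epsilon>
  proof -
    obtain \<delta> where \<delta>: "0 < \<delta>" "\<And>s t. 0 \<le> s \<Longrightarrow> s \<le> t \<Longrightarrow> t \<le> T \<Longrightarrow> t - s < \<delta> \<Longrightarrow>
        w t - w s \<le> \<epsilon> * (H t - H s)"
      using growth[OF \<epsilon>] by blast
    obtain n :: nat where n: "T / \<delta> < real n" using reals_Archimedean2 by blast
    moreover have "0 \<le> T / \<delta>" using \<delta> \<open>0 \<le> T\<close> by simp
    ultimately have n0: "0 < real n" by linarith
    define p where "p k = T * real k / real n" for k
    have step: "p (Suc k) - p k = T / real n" for k by (simp add: p_def distrib_left add_divide_distrib)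
    have "w (p k) - w 0 \<le> \<epsilon> * (H (p k) - H 0)" if "k \<le> n" for k
      using that
    proof (induction k)
      case (Suc k)
      have "T * real (Suc k) \<le> T * real n" using Suc.prems \<open>0 \<le> T\<close> by (intro mult_left_mono) auto
      then have le: "p (Suc k) \<le> T" using n0 by (simp add: p_def divide_le_eq)
      have "w (p (Suc k)) - w (p k) \<le> \<epsilon> * (H (p (Suc k)) - H (p k))"
      proof (rule \<delta>(2)[OF _ _ le])
        show "0 \<le> p k" using n0 \<open>0 \<le> T\<close> by (simp add: p_def)
        show "p k \<le> p (Suc k)" using step[of k] n0 \<open>0 \<le> T\<close> by (smt (verit) divide_nonneg_pos)
        have "T / real n < \<delta>" using n \<delta> n0 by (simp add: field_simps)
        then show "p (Suc k) - p k < \<delta>" by (simp only: step)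
      qed
      with Suc show ?case by (simp add: algebra_simps)
    qed (simp add: p_def)
    from this[of n] n0 show ?thesis by (simp add: p_def)
  qed
  show ?thesis
  proof (rule ccontr)
    assume "\<not> w T \<le> w 0"
    then have d: "0 < w T - w 0" by simp
    \<comment> \<open>An \<open>\<epsilon>\<close> for which the total growth is at most half of what it would have to be.\<close>
    have "w T - w 0 \<le> (w T - w 0) / (2 * (\<bar>H T - H 0\<bar> + 1)) * (H T - H 0)"
      using d by (intro eps) (simp add: add_nonneg_pos)
    also have "\<dots> \<le> (w T - w 0) / (2 * (\<bar>H T - H 0\<bar> + 1)) * (\<bar>H T - H 0\<bar> + 1)"
      using d by (intro mult_left_mono) auto
    also have "\<dots> = (w T - w 0) / 2"
      by (simp add: field_simps add_nonneg_eq_0_iff)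
    finally show False using d by simp
  qed
qed

section \<open>Integrals over growing intervals\<close>

text \<open>Dominated convergence: the indicators of \<open>{0..t}\<close> converge off the limit point, which is no atom.
  The statement covers both integrals in the differential equation.\<close>

lemma continuous_on_set_integral_upto:
  fixes F :: "real \<Rightarrow> 'b::{banach, second_countable_topology}"
  assumes sets: "sets M = sets borel" and atomless: "\<And>t. emeasure M {t} = 0"
    and F: "set_integrable M {0..T} F"
  shows "continuous_on {0..T} (\<lambda>t. LINT s:{0..t}|M. F s)"
proof (rule continuous_on_sequentiallyI)
  fix u :: "nat \<Rightarrow> real" and a
  assume u: "\<forall>n. u n \<in> {0..T}" and a: "a \<in> {0..T}" and lim: "u \<longlonglongrightarrow> a"
  have sub: "set_integrable M {0..t} F" if "t \<le> T" for t
    by (rule set_integrable_subset[OF F]) (use that sets in auto)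
  show "(\<lambda>n. LINT s:{0..u n}|M. F s) \<longlonglongrightarrow> (LINT s:{0..a}|M. F s)"
    unfolding set_lebesgue_integral_def
  proof (rule integral_dominated_convergence[where w = "\<lambda>s. norm (indicator {0..T} s *\<^sub>R F s)"])
    show "(\<lambda>s. indicator {0..a} s *\<^sub>R F s) \<in> borel_measurable M"
      using sub[of a] a unfolding set_integrable_def by auto
    show "(\<lambda>s. indicator {0..u n} s *\<^sub>R F s) \<in> borel_measurable M" for n
      using sub[of "u n"] u unfolding set_integrable_def by auto
    show "integrable M (\<lambda>s. norm (indicator {0..T} s *\<^sub>R F s))"
      using F unfolding set_integrable_def by (rule integrable_norm)
    show "AE s in M. norm (indicator {0..u n} s *\<^sub>R F s) \<le> norm (indicator {0..T} s *\<^sub>R F s)" for n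
    proof (rule AE_I2)
      have "u n \<le> T" using u by auto
      then show "norm (indicator {0..u n} s *\<^sub>R F s) \<le> norm (indicator {0..T} s *\<^sub>R F s)" for s
        by (auto simp: indicator_def)
    qed
    have "{a} \<in> null_sets M" using atomless sets by auto
    then have "AE s in M. s \<noteq> a" by (rule AE_I') auto
    then show "AE s in M. (\<lambda>n. indicator {0..u n} s *\<^sub>R F s) \<longlonglongrightarrow> indicator {0..a} s *\<^sub>R F s"
    proof (rule AE_mp, intro AE_I2 impI)
      fix s assume "s \<noteq> a"
      have "\<forall>\<^sub>F n in sequentially. (u n < s) = (a < s)"
      proof (cases "a < s")
        case True
        then show ?thesis using order_tendstoD(2)[OF lim True] by (auto elim: eventually_mono)
      next
        case False
        then have "s < a" using \<open>s \<noteq> a\<close> by simp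
        from order_tendstoD(1)[OF lim this] show ?thesis
          by eventually_elim (use False in auto)
      qed
      then have "\<forall>\<^sub>F n in sequentially. indicator {0..u n} s *\<^sub>R F s = indicator {0..a} s *\<^sub>R F s"
        by eventually_elim (auto simp: indicator_def not_le)
      then show "(\<lambda>n. indicator {0..u n} s *\<^sub>R F s) \<longlonglongrightarrow> indicator {0..a} s *\<^sub>R F s"
        by (rule tendsto_eventually)
    qed
  qed
qed

lemma set_integral_upto_split:
  fixes F :: "real \<Rightarrow> 'b::{banach, second_countable_topology}"
  assumes sets: "sets M = sets borel" and F: "set_integrable M {0..t} F" and st: "0 \<le> s" "s \<le> t"
  shows "(LINT u:{0..t}|M. F u) = (LINT u:{0..s}|M. F u) + (LINT u:{s<..t}|M. F u)"
proof -
  have "{0..t} = {0..s} \<union> {s<..t}" using st by auto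
  moreover have "(LINT u:{0..s}\<union>{s<..t}|M. F u) = (LINT u:{0..s}|M. F u) + (LINT u:{s<..t}|M. F u)"
  proof (rule set_integral_Un)
    show "set_integrable M {0..s} F" "set_integrable M {s<..t} F"
      by (rule set_integrable_subset[OF F]; use sets st in auto)+
  qed auto
  ultimately show ?thesis by simp
qed

lemma norm_set_integral_le_AE:
  fixes F :: "'a \<Rightarrow> 'b::{banach, second_countable_topology}"
  assumes "set_integrable M S F" "set_integrable M S k" "AE u in M. u \<in> S \<longrightarrow> norm (F u) \<le> k u"
  shows "norm (LINT u:S|M. F u) \<le> (LINT u:S|M. k u)"
proof -
  have "norm (LINT u:S|M. F u) \<le> (LINT u|M. norm (indicator S u *\<^sub>R F u))"
    unfolding set_lebesgue_integral_def by (rule integral_norm_bound)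
  also have "\<dots> \<le> (LINT u:S|M. k u)"
    unfolding set_lebesgue_integral_def
  proof (rule integral_mono_AE)
    show "AE u in M. norm (indicator S u *\<^sub>R F u) \<le> indicator S u *\<^sub>R k u"
      using assms(3) by eventually_elim (auto simp: indicator_def)
    show "integrable M (\<lambda>u. norm (indicator S u *\<^sub>R F u))"
      using assms(1) unfolding set_integrable_def by (rule integrable_norm)
    show "integrable M (\<lambda>u. indicator S u *\<^sub>R k u)"
      using assms(2) unfolding set_integrable_def .
  qed
  finally show ?thesis .
qed

section \<open>The Stieltjes measure of a continuous time change\<close>

text \<open>What almost every path of the inverse of a stable subordinator satisfies. Unboundedness makes the
  image of the path the whole half-line.\<close>

definition time_change_path :: "(real \<Rightarrow> real) \<Rightarrow> bool" where
  "time_change_path e \<longleftrightarrow>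
     e 0 = 0 \<and> continuous_on {0..} e \<and> mono_on {0..} e \<and> (\<forall>b. \<exists>t\<ge>0. b \<le> e t)"

lemma
  assumes e: "time_change_path e"
  shows time_change_path_ext_mono: "s \<le> t \<Longrightarrow> e (max 0 s) \<le> e (max 0 t)"
    and time_change_path_ext_cont: "continuous_on UNIV (\<lambda>t. e (max 0 t))"
    and time_change_path_nonneg: "0 \<le> t \<Longrightarrow> 0 \<le> e t"
proof -
  have m: "mono_on {0..} e" and 0: "e 0 = 0" and c: "continuous_on {0..} e"
    using e by (auto simp: time_change_path_def)
  show "s \<le> t \<Longrightarrow> e (max 0 s) \<le> e (max 0 t)" by (rule mono_onD[OF m]) auto
  show "0 \<le> t \<Longrightarrow> 0 \<le> e t" using mono_onD[OF m, of 0 t] 0 by auto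
  show "continuous_on UNIV (\<lambda>t. e (max 0 t))"
    by (rule continuous_on_compose2[OF c]) (auto intro!: continuous_intros)
qed

lemma sets_path_measure [simp, measurable_cong]: "sets (path_measure e) = sets borel"
  by (simp add: path_measure_def)

lemma space_path_measure [simp]: "space (path_measure e) = UNIV"
  by (simp add: path_measure_def)

lemma emeasure_path_measure_singleton:
  assumes "time_change_path e"
  shows "emeasure (path_measure e) {t} = 0"
  using emeasure_interval_measure_Icc[of t t "\<lambda>t. e (max 0 t)"]
    time_change_path_ext_mono[OF assms] time_change_path_ext_cont[OF assms]
  by (simp add: path_measure_def)

text \<open>Both measures are determined by their values on the sets \<open>{..b}\<close>. For \<open>b \<ge> 0\<close> the preimage of such
  a set is \<open>{..c}\<close>, where \<open>c\<close> is the last point at which the path has the value \<open>b\<close>; intervals on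
  which the path is constant do no harm because they carry no mass.\<close>

lemma distr_path_measure:
  assumes e: "time_change_path e"
  shows "distr (path_measure e) borel (\<lambda>t. e (max 0 t)) = density lborel (indicator {0..})"
proof -
  define F where "F t = e (max 0 t)" for t
  have mono: "F s \<le> F t" if "s \<le> t" for s t
    using time_change_path_ext_mono[OF e that] by (simp add: F_def)
  have cont: "continuous_on UNIV F"
    using time_change_path_ext_cont[OF e] by (simp add: F_def)
  have F_le0: "F t = 0" if "t \<le> 0" for t using that e by (simp add: F_def time_change_path_def)
  have F_nn: "0 \<le> F t" for t using time_change_path_nonneg[OF e] by (simp add: F_def)
  have [measurable]: "F \<in> borel_measurable borel"
    using cont by (rule borel_measurable_continuous_onI)
  have rc: "continuous (at_right a) F" for a
    using cont by (simp add: continuous_on_eq_continuous_at continuous_at_imp_continuous_at_within)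
  have lim: "(F \<longlongrightarrow> 0) at_bot"
    by (rule tendsto_eventually) (auto intro: eventually_mono[OF eventually_le_at_bot[of 0]] F_le0)
  have level: "emeasure (path_measure e) {u. F u \<le> b} = ennreal (if 0 \<le> b then b else 0)" for b
  proof (cases "0 \<le> b")
    case True
    obtain t where t: "t \<ge> 0" "b + 1 \<le> e t" using e by (auto simp: time_change_path_def)
    then have tb: "b + 1 \<le> F t" by (simp add: F_def)
    define S where "S = {u. F u \<le> b}"
    have S: "closed S" unfolding S_def
      by (intro closed_Collect_le cont continuous_on_const)
    have ne: "0 \<in> S" using F_le0[of 0] True by (simp add: S_def)
    have ub: "u \<le> t" if "u \<in> S" for u
    proof (rule ccontr)
      assume "\<not> u \<le> t"
      then have "F t \<le> F u" by (intro mono) simp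
      with tb that show False by (simp add: S_def)
    qed
    have bdd: "bdd_above S" using ub by (rule bdd_aboveI)
    define c where "c = Sup S"
    have cS: "c \<in> S" unfolding c_def using S ne bdd by (intro closed_contains_Sup) auto
    have S_eq: "S = {..c}"
    proof
      show "S \<subseteq> {..c}" using bdd by (auto simp: c_def intro: cSup_upper)
      show "{..c} \<subseteq> S" using cS mono by (force simp: S_def)
    qed
    have "F c = b"
    proof -
      have "0 \<le> t" "F 0 \<le> b" "b \<le> F t" using t ne tb by (auto simp: S_def)
      then obtain x where "F x = b"
        using IVT'[of F 0 b t] cont by (meson continuous_on_subset subset_UNIV)
      then have "x \<le> c" using S_eq by (auto simp: S_def)
      from mono[OF this] \<open>F x = b\<close> cS show ?thesis by (simp add: S_def)
    qed
    then have "emeasure (path_measure e) S = ennreal b"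
      unfolding S_eq path_measure_def
      using emeasure_interval_measure_Iic[of F c, OF mono rc lim] by (simp add: F_def[abs_def])
    with True show ?thesis by (simp add: S_def)
  next
    case False
    then have "{u. F u \<le> b} = {}" using F_nn by (auto simp: not_le intro: less_le_trans)
    with False show ?thesis by simp
  qed
  have 1: "emeasure (distr (path_measure e) borel F) {..b} = ennreal (if 0 \<le> b then b else 0)" for b
    by (subst emeasure_distr) (simp_all add: level[symmetric] vimage_def)
  have 2: "emeasure (density lborel (indicator {0..})) {..b} = ennreal (if 0 \<le> b then b else 0)"
    for b :: real
  proof -
    have "emeasure (density lborel (indicator {0..})) {..b} = emeasure lborel ({0..} \<inter> {..b})"
      by (subst emeasure_density) (simp_all add: indicator_inter_arith[symmetric])
    also have "{0..} \<inter> {..b} = {0..b}" by auto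
    finally show ?thesis by simp
  qed
  have "distr (path_measure e) borel F = density lborel (indicator {0..})"
  proof (rule measure_eqI_generator_eq[where E = "range atMost" and \<Omega> = UNIV
            and A = "\<lambda>n. {..real n}"])
    show "Int_stable (range (atMost :: real \<Rightarrow> real set))"
      by (auto simp: Int_stable_def intro: image_eqI[of _ _ "min a b" for a b])
    show "emeasure (distr (path_measure e) borel F) X = emeasure (density lborel (indicator {0..})) X"
      if "X \<in> range atMost" for X using that 1 2 by auto
    have b: "sets borel = sigma_sets UNIV (range (atMost :: real \<Rightarrow> real set))"
      by (subst borel_eq_atMost) simp
    show "sets (distr (path_measure e) borel F) = sigma_sets UNIV (range atMost)"
      "sets (density lborel (indicator {0..})) = sigma_sets UNIV (range (atMost :: real \<Rightarrow> real set))"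
      by (simp_all add: b)
    show "(\<Union>i. {..real i}) = UNIV" by (auto intro: real_arch_simple)
    show "emeasure (distr (path_measure e) borel F) {..real i} \<noteq> \<infinity>" for i by (simp add: 1)
  qed auto
  then show ?thesis by (simp add: F_def[abs_def])
qed

text \<open>The points where \<open>P\<close> fails need not form a Borel set, so they are enclosed in a Borel null set
  before they are pulled back along the path.\<close>

lemma AE_path_measure_compose:
  assumes e: "time_change_path e" and P: "AE v in lborel. P v"
  shows "AE u in path_measure e. P (e (max 0 u))"
proof -
  have [measurable]: "(\<lambda>t. e (max 0 t)) \<in> borel_measurable borel"
    by (rule borel_measurable_continuous_onI[OF time_change_path_ext_cont[OF e]])
  obtain N where N: "{v. \<not> P v} \<subseteq> N" "N \<in> sets borel" "emeasure lborel N = 0"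
    using AE_E[OF P] by auto
  then have "AE v in lborel. v \<notin> N" by (intro AE_not_in) auto
  then have "AE v in density lborel (indicator {0..}). v \<notin> N"
    by (subst AE_density) auto
  then have "AE v in distr (path_measure e) borel (\<lambda>t. e (max 0 t)). v \<notin> N"
    by (simp only: distr_path_measure[OF e])
  then have "AE u in path_measure e. e (max 0 u) \<notin> N"
    by (subst (asm) AE_distr_iff) (use N in \<open>auto simp: Compl_eq[symmetric] intro: measurable_cong_sets\<close>)
  then show ?thesis by eventually_elim (use N in auto)
qed

lemma integral_path_measure_compose:
  fixes h :: "real \<Rightarrow> real"
  assumes e: "time_change_path e" and h: "integrable lborel h" "h \<in> borel_measurable borel"
    and nn: "\<And>v. 0 \<le> h v"
  shows "integrable (path_measure e) (\<lambda>u. h (e (max 0 u)))"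
    and "(LINT u|path_measure e. h (e (max 0 u))) \<le> (LINT v|lborel. h v)"
proof -
  note [measurable] = h(2)
  have [measurable]: "(\<lambda>t. e (max 0 t)) \<in> borel_measurable borel"
    by (rule borel_measurable_continuous_onI[OF time_change_path_ext_cont[OF e]])
  have int: "integrable lborel (\<lambda>v. indicator {0..} v * h v)"
    using integrable_mult_indicator[of "{0..}" lborel h] h by simp
  have ind: "(indicator {0..} :: real \<Rightarrow> ennreal) = (\<lambda>v. ennreal (indicator {0..} v))"
    by (auto simp: indicator_def)
  have i: "integrable (density lborel (indicator {0..})) h"
    unfolding ind by (subst integrable_density) (use int in auto)
  show "integrable (path_measure e) (\<lambda>u. h (e (max 0 u)))"
    by (subst integrable_distr_eq[of _ _ borel, symmetric]) (simp_all add: distr_path_measure[OF e] i)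
  have "(LINT u|path_measure e. h (e (max 0 u)))
      = (LINT v|distr (path_measure e) borel (\<lambda>t. e (max 0 t)). h v)"
    by (rule integral_distr[symmetric]) simp_all
  also have "\<dots> = (LINT v|lborel. indicator {0..} v * h v)"
    unfolding distr_path_measure[OF e] ind by (subst integral_density) auto
  also have "\<dots> \<le> (LINT v|lborel. h v)"
    by (intro integral_mono int h(1)) (auto simp: indicator_def nn)
  finally show "(LINT u|path_measure e. h (e (max 0 u))) \<le> (LINT v|lborel. h v)" .
qed

section \<open>Decay along a single path\<close>

text \<open>The deterministic core: each short interval contributes a factor \<open>exp (- l * \<Delta>t + \<Delta>G)\<close>, and these
  multiply up to \<open>exp (- l * T + G T)\<close>. The nonlinearity is bounded only almost everywhere with
  respect to the Stieltjes measure, because \<open>h\<close> will be a Borel function that agrees with \<open>\<parallel>g\<parallel>\<close>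
  almost everywhere.\<close>

lemma path_solution_decay:
  fixes A :: "real^'n^'n" and N :: "real^'n \<Rightarrow> real" and h :: "real \<Rightarrow> real"
  assumes l: "0 < l" and h0: "0 < h0" and C: "0 < C"
    and N_ge: "\<And>v. norm v \<le> N v" and N_le: "\<And>v. N v \<le> C * norm v"
    and N_add: "\<And>u v. N (u + v) \<le> N u + N v"
    and N_step: "\<And>r v. 0 \<le> r \<Longrightarrow> r \<le> h0 \<Longrightarrow> N (v + r *\<^sub>R (A *v v)) \<le> (1 - l * r) * N v"
    and e: "time_change_path e" and sol: "path_solution A f e x0 x"
    and h: "integrable lborel h" "h \<in> borel_measurable borel" "\<And>v. 0 \<le> h v"
    and f_le: "AE u in path_measure e. 0 \<le> u \<longrightarrow> norm (f (e u) (x u)) \<le> h (e u) * norm (x u)"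
    and T: "0 \<le> T"
  shows "N (x T) \<le> N x0 * exp (C * (LINT v|lborel. h v)) * exp (- l * T)"
proof -
  define \<mu> where "\<mu> = path_measure e"
  have \<mu>_sets: "sets \<mu> = sets borel" by (simp add: \<mu>_def)
  have atom: "emeasure \<mu> {t} = 0" for t
    using emeasure_path_measure_singleton[OF e] by (simp add: \<mu>_def)
  define k where "k u = h (e (max 0 u))" for u
  have k_nn: "0 \<le> k u" for u by (simp add: k_def h)
  have k_int: "integrable \<mu> k" and k_le: "(LINT u|\<mu>. k u) \<le> (LINT v|lborel. h v)"
    using integral_path_measure_compose[OF e h] by (simp_all add: \<mu>_def k_def[abs_def])
  have k_set: "set_integrable \<mu> S k" if "S \<in> sets borel" for S
    unfolding set_integrable_def using k_int that \<mu>_sets by (intro integrable_mult_indicator) auto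
  define G where "G t = C * (LINT u:{0..t}|\<mu>. k u)" for t
  define \<phi> where "\<phi> u = f (e u) (x u)" for u
  have a_int: "set_integrable lborel {0..t} (\<lambda>s. A *v x s)"
    and \<phi>_int: "set_integrable \<mu> {0..t} \<phi>"
    and x_eq: "x t = x0 + (LINT s:{0..t}|lborel. A *v x s) + (LINT s:{0..t}|\<mu>. \<phi> s)"
    if "0 \<le> t" for t
    using sol that unfolding path_solution_def \<mu>_def \<phi>_def[abs_def] by auto
  have point: "(LINT s:{0..0}|M. F s) = 0" if "sets M = sets borel" "emeasure M {0::real} = 0"
    for M and F :: "real \<Rightarrow> 'b::{banach, second_countable_topology}"
  proof -
    have "{0} \<in> null_sets M" using that by auto
    then have "AE s in M. s \<noteq> 0" by (rule AE_I') auto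
    then have "AE s in M. indicator {0..0} s *\<^sub>R F s = 0" by eventually_elim auto
    then show ?thesis unfolding set_lebesgue_integral_def by (rule integral_eq_zero_AE)
  qed
  have x_0: "x 0 = x0" using x_eq[of 0] by (simp add: point \<mu>_sets atom del: atLeastAtMost_singleton)
  have G_0: "G 0 = 0" by (simp add: G_def point \<mu>_sets atom del: atLeastAtMost_singleton)
  have x_cont: "continuous_on {0..T} x"
  proof -
    have "continuous_on {0..T} (\<lambda>t. x0 + (LINT s:{0..t}|lborel. A *v x s) + (LINT s:{0..t}|\<mu>. \<phi> s))"
      by (intro continuous_intros continuous_on_set_integral_upto a_int \<phi>_int T \<mu>_sets atom) simp_all
    then show ?thesis by (rule continuous_on_eq) (simp add: x_eq)
  qed
  then have x_unif: "uniformly_continuous_on {0..T} x"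
    by (intro compact_uniformly_continuous compact_Icc)
  obtain D where D: "0 < D" "\<And>v. norm (A *v v) \<le> D * norm v"
    using linear_bounded_pos[OF matrix_vector_mul_linear[of A]] by blast
  have N_nn: "0 \<le> N v" for v using norm_ge_zero N_ge by (rule order_trans)
  have G_incr: "G t - G s = C * (LINT u:{s<..t}|\<mu>. k u)" if "0 \<le> s" "s \<le> t" for s t
    using set_integral_upto_split[OF \<mu>_sets k_set that]
    by (simp add: G_def algebra_simps)
  have incr_nn: "0 \<le> (LINT u:{s<..t}|\<mu>. k u)" for s t
    unfolding set_lebesgue_integral_def by (intro integral_nonneg_AE AE_I2) (simp add: k_nn)
  have G_mono: "G s \<le> G t" if "0 \<le> s" "s \<le> t" for s t
    using G_incr[OF that] incr_nn[of s t] C by (smt (verit) mult_nonneg_nonneg)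
  \<comment> \<open>The factor \<open>exp \<dots>\<close> collects the contraction and the effect of the nonlinearity at \<open>x s\<close>; the
    last summand is the error from replacing \<open>x u\<close> by \<open>x s\<close> in both integrals.\<close>
  have one_step: "N (x t) \<le> exp (- l * (t - s) + (G t - G s)) * N (x s)
        + \<eta> * (C * D + 1) * ((t + G t) - (s + G s))"
    if \<eta>: "0 < \<eta>" and st: "0 \<le> s" "s \<le> t" "t \<le> T" "t - s \<le> h0"
      and osc: "\<And>u. s \<le> u \<Longrightarrow> u \<le> t \<Longrightarrow> norm (x u - x s) \<le> \<eta>" for \<eta> s t
  proof -
    define I1 where "I1 = (LINT u:{s<..t}|lborel. A *v x u - A *v x s)"
    define I2 where "I2 = (LINT u:{s<..t}|\<mu>. \<phi> u)"
    have t0: "0 \<le> t" using st by simp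
    have a_sub: "set_integrable lborel {s<..t} (\<lambda>u. A *v x u)"
      by (rule set_integrable_subset[OF a_int[OF t0]]) (use st in auto)
    have c_sub: "set_integrable lborel {s<..t} (\<lambda>u. c)" for c :: "'b::{banach,second_countable_topology}"
      unfolding set_integrable_def by (rule integrable_scaleR_left) (use st in \<open>simp add: integrable_indicator_iff\<close>)
    have \<phi>_sub: "set_integrable \<mu> {s<..t} \<phi>"
      by (rule set_integrable_subset[OF \<phi>_int[OF t0]]) (use st \<mu>_sets in auto)
    have c_val: "(LINT u:{s<..t}|lborel. c) = (t - s) *\<^sub>R c" for c :: "'b::{banach,second_countable_topology}"
      unfolding set_lebesgue_integral_def using st by (subst integral_scaleR_left) (auto simp: integrable_indicator_iff)
    have "x t = x s + (LINT u:{s<..t}|lborel. A *v x u) + I2"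
      using x_eq[of t] x_eq[of s] st set_integral_upto_split[OF _ a_int[OF t0] st(1,2)]
        set_integral_upto_split[OF \<mu>_sets \<phi>_int[OF t0] st(1,2)] by (simp add: I2_def)
    also have "(LINT u:{s<..t}|lborel. A *v x u) = (t - s) *\<^sub>R (A *v x s) + I1"
      unfolding I1_def by (subst set_integral_diff(2)[OF a_sub c_sub]) (simp add: c_val)
    finally have x_t: "x t = (x s + (t - s) *\<^sub>R (A *v x s)) + (I1 + I2)" by simp
    have "norm I1 \<le> (LINT u:{s<..t}|lborel. D * \<eta>)"
      unfolding I1_def
    proof (rule norm_set_integral_le_AE)
      show "AE u in lborel. u \<in> {s<..t} \<longrightarrow> norm (A *v x u - A *v x s) \<le> D * \<eta>"
      proof (intro AE_I2 impI)
        fix u assume "u \<in> {s<..t}"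
        then have "norm (x u - x s) \<le> \<eta>" by (intro osc) auto
        then have "D * norm (x u - x s) \<le> D * \<eta>" using D by simp
        with D(2)[of "x u - x s"] show "norm (A *v x u - A *v x s) \<le> D * \<eta>"
          by (simp add: matrix_vector_mult_diff_distrib)
      qed
    qed (intro set_integral_diff a_sub c_sub)+
    then have I1: "norm I1 \<le> (t - s) * (D * \<eta>)" by (simp add: c_val mult_ac)
    have "norm I2 \<le> (LINT u:{s<..t}|\<mu>. k u * (N (x s) + \<eta>))"
      unfolding I2_def
    proof (rule norm_set_integral_le_AE[OF \<phi>_sub])
      show "set_integrable \<mu> {s<..t} (\<lambda>u. k u * (N (x s) + \<eta>))"
        by (intro set_integrable_mult_left k_set) auto
      show "AE u in \<mu>. u \<in> {s<..t} \<longrightarrow> norm (\<phi> u) \<le> k u * (N (x s) + \<eta>)"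
        using f_le unfolding \<mu>_def[symmetric]
      proof (rule AE_mp, intro AE_I2 impI)
        fix u assume fu: "0 \<le> u \<longrightarrow> norm (f (e u) (x u)) \<le> h (e u) * norm (x u)"
          and u: "u \<in> {s<..t}"
        then have "norm (\<phi> u) \<le> k u * norm (x u)" using st by (simp add: \<phi>_def k_def)
        moreover have "norm (x u) \<le> N (x s) + \<eta>"
          using norm_triangle_ineq2[of "x u" "x s"] osc[of u] N_ge[of "x s"] u by auto
        then have "k u * norm (x u) \<le> k u * (N (x s) + \<eta>)" using k_nn by (rule mult_left_mono)
        ultimately show "norm (\<phi> u) \<le> k u * (N (x s) + \<eta>)" by linarith
      qed
    qed
    then have "norm I2 \<le> (LINT u:{s<..t}|\<mu>. k u) * (N (x s) + \<eta>)" by simp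
    then have I2: "C * norm I2 \<le> (G t - G s) * (N (x s) + \<eta>)"
      using C G_incr[OF st(1,2)] by (simp add: mult.assoc mult_left_mono)
    have I12: "N (I1 + I2) \<le> C * norm I1 + C * norm I2"
      using N_add[of I1 I2] N_le[of I1] N_le[of I2] by linarith
    have CI1: "C * norm I1 \<le> \<eta> * (C * D) * (t - s)"
      using mult_left_mono[OF I1, of C] C by (simp add: mult_ac)
    have "N (x t) \<le> (1 - l * (t - s)) * N (x s) + (C * norm I1 + C * norm I2)"
      unfolding x_t using N_add[of "x s + (t - s) *\<^sub>R (A *v x s)" "I1 + I2"] I12
        N_step[of "t - s" "x s"] st by linarith
    also have "\<dots> \<le> (1 + (- l * (t - s) + (G t - G s))) * N (x s)
        + (\<eta> * (C * D) * (t - s) + \<eta> * (G t - G s))"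
      using CI1 I2 by (simp add: algebra_simps)
    also have "\<dots> \<le> exp (- l * (t - s) + (G t - G s)) * N (x s)
        + \<eta> * (C * D + 1) * ((t + G t) - (s + G s))"
    proof (rule add_mono)
      show "(1 + (- l * (t - s) + (G t - G s))) * N (x s)
          \<le> exp (- l * (t - s) + (G t - G s)) * N (x s)"
        by (intro mult_right_mono exp_ge_add_one_self N_nn)
      have "0 \<le> \<eta> * (C * D) * (G t - G s)" "0 \<le> \<eta> * (t - s)"
        using \<eta> C D G_mono[OF st(1,2)] st by auto
      then show "\<eta> * (C * D) * (t - s) + \<eta> * (G t - G s)
          \<le> \<eta> * (C * D + 1) * ((t + G t) - (s + G s))" by (simp add: algebra_simps)
    qed
    finally show ?thesis .
  qed
  define w where "w t = exp (l * t - G t) * N (x t)" for t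
  have "w T \<le> w 0"
  proof (rule le_of_infinitesimal_growth[where H = "\<lambda>t. t + G t", OF T])
    fix \<epsilon> :: real assume \<epsilon>: "0 < \<epsilon>"
    \<comment> \<open>The error of one step is multiplied by the weight of \<open>w\<close>, which is at most \<open>exp (l * T)\<close>.\<close>
    define \<eta> where "\<eta> = \<epsilon> / (exp (l * T) * (C * D + 1))"
    have CD: "0 < C * D + 1" using C D by (simp add: add_pos_pos)
    have \<eta>: "0 < \<eta>" using \<epsilon> CD by (simp add: \<eta>_def)
    obtain d where d: "0 < d"
      "\<And>u s. u \<in> {0..T} \<Longrightarrow> s \<in> {0..T} \<Longrightarrow> dist u s < d \<Longrightarrow> dist (x u) (x s) < \<eta>"
      using x_unif \<eta> unfolding uniformly_continuous_on_def by metis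
    show "\<exists>\<delta>>0. \<forall>s t. 0 \<le> s \<and> s \<le> t \<and> t \<le> T \<and> t - s < \<delta> \<longrightarrow>
            w t - w s \<le> \<epsilon> * (t + G t - (s + G s))"
    proof (intro exI[of _ "min d h0"] conjI allI impI)
      show "0 < min d h0" using d h0 by simp
      fix s t assume "0 \<le> s \<and> s \<le> t \<and> t \<le> T \<and> t - s < min d h0"
      then have st: "0 \<le> s" "s \<le> t" "t \<le> T" "t - s < d" "t - s \<le> h0" by auto
      define \<Delta> where "\<Delta> = t + G t - (s + G s)"
      have \<Delta>: "0 \<le> \<Delta>" using st G_mono[OF st(1,2)] by (simp add: \<Delta>_def)
      have "N (x t) \<le> exp (- l * (t - s) + (G t - G s)) * N (x s) + \<eta> * (C * D + 1) * \<Delta>"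
        unfolding \<Delta>_def
      proof (rule one_step[OF \<eta> st(1,2,3,5)])
        fix u assume "s \<le> u" "u \<le> t"
        then have "dist (x u) (x s) < \<eta>" using st by (intro d) (auto simp: dist_real_def)
        then show "norm (x u - x s) \<le> \<eta>" by (simp add: dist_norm)
      qed
      then have "w t \<le> exp (l * t - G t) *
          (exp (- l * (t - s) + (G t - G s)) * N (x s) + \<eta> * (C * D + 1) * \<Delta>)"
        unfolding w_def by (intro mult_left_mono) auto
      also have "\<dots> = w s + exp (l * t - G t) * (\<eta> * (C * D + 1) * \<Delta>)"
      proof -
        have "exp (l * t - G t) * exp (- l * (t - s) + (G t - G s)) = exp (l * s - G s)"
          by (simp add: exp_add[symmetric] algebra_simps)
        then show ?thesis by (simp add: w_def distrib_left mult.assoc[symmetric])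
      qed
      also have "\<dots> \<le> w s + exp (l * T) * (\<eta> * (C * D + 1) * \<Delta>)"
      proof (intro add_left_mono mult_right_mono)
        have "0 \<le> G t" using G_mono[of 0 t] st G_0 by simp
        moreover have "l * t \<le> l * T" using l st by simp
        ultimately show "exp (l * t - G t) \<le> exp (l * T)" by simp
        show "0 \<le> \<eta> * (C * D + 1) * \<Delta>" using \<eta> CD \<Delta> by simp
      qed
      also have "exp (l * T) * (\<eta> * (C * D + 1) * \<Delta>) = \<epsilon> * \<Delta>"
        using CD by (simp add: \<eta>_def)
      finally show "w t - w s \<le> \<epsilon> * (t + G t - (s + G s))" by (simp add: \<Delta>_def)
    qed
  qed
  then have wT: "exp (l * T - G T) * N (x T) \<le> N x0" by (simp add: w_def x_0 G_0)
  have "(LINT u:{0..T}|\<mu>. k u) \<le> (LINT u|\<mu>. k u)"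
    unfolding set_lebesgue_integral_def
    by (rule integral_mono[OF k_set[unfolded set_integrable_def] k_int])
       (auto simp: indicator_def k_nn)
  then have GT: "G T \<le> C * (LINT v|lborel. h v)"
    using k_le C by (simp add: G_def)
  have "N (x T) = exp (G T - l * T) * (exp (l * T - G T) * N (x T))"
    by (simp add: mult.assoc[symmetric] exp_add[symmetric])
  also have "\<dots> \<le> exp (G T - l * T) * N x0" using wT by (intro mult_left_mono) auto
  also have "\<dots> \<le> exp (C * (LINT v|lborel. h v) - l * T) * N x0"
    using GT by (intro mult_right_mono N_nn) simp
  finally show ?thesis by (simp add: exp_diff exp_minus field_simps)
qed

section \<open>Paths of the inverse subordinator\<close>

text \<open>Strict monotonicity of \<open>u\<close> makes its inverse a left inverse, \<open>e (u s) = s\<close>. So \<open>e\<close> is monotone and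
  onto the half-line, and a monotone surjection cannot jump. The jumps of \<open>u\<close> become
  the flat pieces of \<open>e\<close>.\<close>

lemma time_change_path_inverse:
  fixes u :: "real \<Rightarrow> real"
  assumes strict: "strict_mono_on {0..} u" and u0: "u 0 = 0"
    and unbdd: "\<And>b. \<exists>s\<ge>0. b < u s"
  shows "time_change_path (\<lambda>t. Inf {s. 0 < s \<and> t < u s})"
proof -
  define e where "e t = Inf {s. 0 < s \<and> t < u s}" for t
  have e_u: "e (u s) = s" if "0 \<le> s" for s
  proof -
    have "{r. 0 < r \<and> u s < u r} = {s<..}"
      using that strict_mono_on_less[OF strict, of s] by auto
    then show ?thesis by (simp add: e_def)
  qed
  have ne: "{s. 0 < s \<and> t < u s} \<noteq> {}" for t
  proof -
    obtain s where "s \<ge> 0" "max 0 t < u s" using unbdd by blast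
    moreover from this have "s \<noteq> 0" using u0 by auto
    ultimately have "s \<in> {s. 0 < s \<and> t < u s}" by auto
    then show ?thesis by blast
  qed
  have bdd: "bdd_below {s. 0 < s \<and> t < u s}" for t by (rule bdd_belowI[of _ 0]) auto
  have mono: "e s \<le> e t" if "s \<le> t" for s t
    unfolding e_def using that by (intro cInf_superset_mono ne bdd) auto
  have nn: "0 \<le> e t" for t unfolding e_def by (rule cInf_greatest[OF ne]) auto
  have e0: "e 0 = 0" using e_u[of 0] u0 by simp
  \<comment> \<open>Continued by the identity, \<open>e\<close> becomes onto the whole line, so that its image is open.\<close>
  define F where "F t = (if 0 \<le> t then e t else t)" for t
  have "y \<in> range F" for y
  proof (cases "0 \<le> y")
    case True
    then have "0 \<le> u y" using strict_mono_on_leD[OF strict, of 0 y] u0 by auto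
    then have "F (u y) = y" by (simp add: F_def e_u True)
    then show ?thesis by (metis rangeI)
  next
    case False
    then have "F y = y" by (simp add: F_def)
    then show ?thesis by (metis rangeI)
  qed
  then have "range F = UNIV" by auto
  then have "continuous_on UNIV F"
  proof (intro continuous_onI_mono)
    show "F s \<le> F t" if "s \<le> t" for s t
      using that mono[OF that] nn[of t] by (auto simp: F_def)
  qed simp
  then have "continuous_on {0..} F" by (rule continuous_on_subset) simp
  then have cont: "continuous_on {0..} e" by (rule continuous_on_eq) (simp add: F_def)
  have "\<exists>t\<ge>0. b \<le> e t" for b
    using e_u[of "max 0 b"] strict_mono_on_leD[OF strict, of 0 "max 0 b"] u0
    by (intro exI[of _ "u (max 0 b)"]) auto
  then have "time_change_path e"
    using e0 cont mono by (auto simp: time_change_path_def intro: mono_onI)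
  then show ?thesis by (simp add: e_def[abs_def])
qed

text \<open>Exponential Markov bound: by the Laplace transform at 1, the probability that \<open>U m \<le> b\<close> is at
  most \<open>exp (b - m)\<close>, which tends to 0.\<close>

lemma subordinator_unbounded:
  assumes "prob_space M" and U: "stable_subordinator M \<beta> U"
  shows "AE \<omega> in M. \<forall>b. \<exists>s\<ge>0. b < U s \<omega>"
proof -
  interpret prob_space M by fact
  have meas: "U t \<in> borel_measurable M" if "0 \<le> t" for t
    using U that by (simp add: stable_subordinator_def levy_process_def)
  have [measurable]: "U (real m) \<in> borel_measurable M" for m by (simp add: meas)
  have laplace: "(LINT \<omega>|M. exp (- U (real m) \<omega>)) = exp (- real m)" for m
  proof -
    have "(LINT \<omega>|M. exp (- 1 * U (real m) \<omega>)) = exp (- real m * 1 powr \<beta>)"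
      using U unfolding stable_subordinator_def by (meson of_nat_0_le_iff zero_le_one)
    then show ?thesis by simp
  qed
  have int: "integrable M (\<lambda>\<omega>. exp (- U (real m) \<omega>))" for m
    using laplace[of m] not_integrable_integral_eq by fastforce
  have "AE \<omega> in M. \<exists>m::nat. real j < U (real m) \<omega>" for j :: nat
  proof -
    define B where "B = {\<omega> \<in> space M. \<forall>m::nat. U (real m) \<omega> \<le> real j}"
    have B [measurable]: "B \<in> sets M" unfolding B_def by measurable
    have bound: "prob B \<le> exp (real j - real m)" for m :: nat
    proof -
      have "exp (- real j) * prob B = (LINT \<omega>|M. exp (- real j) * indicator B \<omega>)" by simp
      also have "\<dots> \<le> (LINT \<omega>|M. exp (- U (real m) \<omega>))"
      proof (rule integral_mono[OF _ int])
        show "exp (- real j) * indicator B \<omega> \<le> exp (- U (real m) \<omega>)" for \<omega>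
          by (auto simp: B_def indicator_def)
      qed (auto intro!: integrable_real_indicator simp: less_top[symmetric])
      finally have "exp (- real j) * prob B \<le> exp (- real m)" by (simp only: laplace)
      then show ?thesis by (simp add: exp_diff exp_minus field_simps)
    qed
    have "(\<lambda>m. exp (real j - real m)) \<longlonglongrightarrow> 0"
      by real_asymp
    then have "prob B \<le> 0" by (rule LIMSEQ_le_const) (use bound in auto)
    then have "B \<in> null_sets M"
      by (auto simp: null_sets_def emeasure_eq_measure measure_le_0_iff)
    then show ?thesis by (rule AE_I') (auto simp: B_def not_less)
  qed
  then have "AE \<omega> in M. \<forall>j::nat. \<exists>m::nat. real j < U (real m) \<omega>" by (simp add: AE_all_countable)
  then show ?thesis
  proof eventually_elim
    case (elim \<omega>)
    show ?case
    proof
      fix b :: real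
      obtain j :: nat where "b < real j" using reals_Archimedean2 by blast
      moreover obtain m :: nat where "real j < U (real m) \<omega>" using elim by blast
      ultimately show "\<exists>s\<ge>0. b < U s \<omega>" by (intro exI[of _ "real m"]) auto
    qed
  qed
qed

lemma AE_time_change_path_inverse_process:
  assumes "prob_space M" and U: "stable_subordinator M \<beta> U"
  shows "AE \<omega> in M. time_change_path (\<lambda>t. inverse_process U t \<omega>)"
proof -
  have "AE \<omega> in M. U 0 \<omega> = 0" "AE \<omega> in M. strict_mono_on {0..} (\<lambda>t. U t \<omega>)"
    using U by (auto simp: stable_subordinator_def levy_process_def)
  with subordinator_unbounded[OF assms] show ?thesis
  proof eventually_elim
    case (elim \<omega>)
    then show ?case
      using time_change_path_inverse[of "\<lambda>t. U t \<omega>"] by (simp add: inverse_process_def)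
  qed
qed

text \<open>Absolute integrability makes \<open>r\<close> only Lebesgue measurable, while composing with a path and
  integrating against its Stieltjes measure calls for a Borel function.\<close>

lemma borel_representative_on_half_line:
  fixes r :: "real \<Rightarrow> real"
  assumes r: "r absolutely_integrable_on {0..}" and nn: "\<And>s. 0 \<le> r s"
  obtains h where "integrable lborel h" "h \<in> borel_measurable borel" "\<And>v. 0 \<le> h v"
    "AE v in lborel. 0 \<le> v \<longrightarrow> r v = h v"
proof -
  define r0 where "r0 v = indicator {0..} v * r v" for v
  have r0: "integrable lebesgue r0"
    using r by (simp add: set_integrable_def r0_def[abs_def])
  then obtain h0 where h0 [measurable]: "h0 \<in> borel_measurable lborel"
    and eq0: "AE v in lborel. r0 v = h0 v"
    using completion_ex_borel_measurable_real[of r0 lborel] by auto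
  from eq0 have eq: "AE v in lborel. r0 v = \<bar>h0 v\<bar>"
  proof eventually_elim
    case (elim v)
    have "0 \<le> r0 v" by (simp add: r0_def nn)
    with elim show ?case by simp
  qed
  have "integrable lebesgue (\<lambda>v. \<bar>h0 v\<bar>)"
  proof (rule integrable_cong_AE_imp[OF r0])
    show "(\<lambda>v. \<bar>h0 v\<bar>) \<in> borel_measurable lebesgue" by (rule measurable_completion) measurable
    show "AE v in lebesgue. r0 v = \<bar>h0 v\<bar>" by (rule AE_completion[OF eq])
  qed
  then have "integrable lborel (\<lambda>v. \<bar>h0 v\<bar>)" by (subst (asm) integrable_completion) auto
  moreover have "AE v in lborel. 0 \<le> v \<longrightarrow> r v = \<bar>h0 v\<bar>"
    using eq by eventually_elim (auto simp: r0_def)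
  ultimately show ?thesis using that[of "\<lambda>v. \<bar>h0 v\<bar>"] h0 by auto
qed

section \<open>Stability of the trivial solution\<close>

lemma stable_if_uniform_exponential_bound:
  fixes X :: "real^'n \<Rightarrow> real \<Rightarrow> 'w \<Rightarrow> real^'n"
  assumes "prob_space M" and meas: "\<And>x0 t. 0 \<le> t \<Longrightarrow> X x0 t \<in> borel_measurable M"
    and l: "0 < l" and K: "0 < K"
    and bound: "AE \<omega> in M. \<forall>t\<ge>0. \<forall>x0. norm (X x0 t \<omega>) \<le> K * norm x0 * exp (- l * t)"
  shows "exp_sample_path_stable M X \<and> (\<forall>p\<ge>1. moment_exp_stable M p X)"
proof (intro conjI allI impI)
  interpret prob_space M by fact
  show "exp_sample_path_stable M X"
    unfolding exp_sample_path_stable_def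
    by (rule exI[of _ "\<lambda>t. t"]) (use l K bound filterlim_ident in blast)
  fix p :: real assume p: "1 \<le> p"
  show "moment_exp_stable M p X"
    unfolding moment_exp_stable_def
  proof (rule exI[of _ "l * p"], rule exI[of _ "K powr p"], intro conjI allI impI)
    show "0 < l * p" "0 < K powr p" using l K p by auto
    fix t and x0 :: "real^'n" assume t: "(0::real) \<le> t"
    note [measurable] = meas[OF t]
    define c where "c = K powr p * norm x0 powr p * exp (- (l * p) * t)"
    have le: "AE \<omega> in M. norm (X x0 t \<omega>) powr p \<le> c"
      using bound
    proof eventually_elim
      case (elim \<omega>)
      then have "norm (X x0 t \<omega>) powr p \<le> (K * norm x0 * exp (- l * t)) powr p"
        using t p by (intro powr_mono2) auto
      also have "\<dots> = c"
        using K by (simp add: c_def powr_mult exp_powr_real mult_ac)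
      finally show ?case .
    qed
    show int: "integrable M (\<lambda>\<omega>. norm (X x0 t \<omega>) powr p)"
      by (rule integrable_const_bound[of _ c]) (use le in auto)
    show "(LINT \<omega>|M. norm (X x0 t \<omega>) powr p) \<le> K powr p * norm x0 powr p * exp (- (l * p) * t)"
      using integral_mono_AE[OF int integrable_const le] by (simp add: prob_space c_def)
  qed
qed


theorem theorem3p2:
  fixes M :: "'w measure" and \<beta> :: real and U E :: "real \<Rightarrow> 'w \<Rightarrow> real"
    and A :: "real^'n^'n" and f :: "real \<Rightarrow> real^'n \<Rightarrow> real^'n" and g :: "real \<Rightarrow> real^'n"
    and X :: "real^'n \<Rightarrow> real \<Rightarrow> 'w \<Rightarrow> real^'n"
  assumes "prob_space M"
    and "0 < \<beta>" and "\<beta> < 1"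
    and "stable_subordinator M \<beta> U"
    and "E = inverse_process U"
    and "\<forall>z\<in>matrix_spectrum A. Re z < 0"
    and "solution_family M A f E X"
    and "AE \<omega> in M. \<forall>t\<ge>0. f (E t \<omega>) 0 = 0"
    and "AE \<omega> in M. \<forall>x0. \<forall>t\<ge>0.
           norm (f (E t \<omega>) (X x0 t \<omega>)) \<le> norm (g (E t \<omega>)) * norm (X x0 t \<omega>)"
    and "(\<lambda>s. norm (g s)) absolutely_integrable_on {0..}"
  shows "exp_sample_path_stable M X \<and> (\<forall>p\<ge>1. moment_exp_stable M p X)"
proof -
  obtain N l h0 C where l: "0 < l" and h0: "0 < h0" and C: "0 < C"
    and N_ge: "\<And>v::real^'n. norm v \<le> N v" and N_le: "\<And>v. N v \<le> C * norm v"
    and N_add: "\<And>u v. N (u + v) \<le> N u + N v"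
    and N_step: "\<And>r v. 0 \<le> r \<Longrightarrow> r \<le> h0 \<Longrightarrow> N (v + r *\<^sub>R (A *v v)) \<le> (1 - l * r) * N v"
    by (rule hurwitz_adapted_norm[OF assms(6)]) (rule that)
  obtain h where h: "integrable lborel h" "h \<in> borel_measurable borel" "\<And>v. 0 \<le> h v"
    and gh: "AE v in lborel. 0 \<le> v \<longrightarrow> norm (g v) = h v"
    by (rule borel_representative_on_half_line[OF assms(10) norm_ge_zero]) (rule that)
  define K where "K = C * exp (C * (LINT v|lborel. h v))"
  have meas: "X x0 t \<in> borel_measurable M" if "0 \<le> t" for x0 t
    using assms(7) that by (simp add: solution_family_def)
  have "AE \<omega> in M. \<forall>x0. path_solution A f (\<lambda>t. E t \<omega>) x0 (\<lambda>t. X x0 t \<omega>)"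
    using assms(7) by (simp add: solution_family_def)
  moreover have "AE \<omega> in M. time_change_path (\<lambda>t. E t \<omega>)"
    using AE_time_change_path_inverse_process[OF assms(1,4)] by (simp add: assms(5))
  ultimately have "AE \<omega> in M. \<forall>t\<ge>0. \<forall>x0. norm (X x0 t \<omega>) \<le> K * norm x0 * exp (- l * t)"
    using assms(9)
  proof eventually_elim
    case (elim \<omega>)
    define e where "e t = E t \<omega>" for t
    have e: "time_change_path e" using elim(2) by (simp add: e_def[abs_def])
    show ?case
    proof (intro allI impI)
      fix t :: real and x0 assume t: "0 \<le> t"
      define x where "x s = X x0 s \<omega>" for s
      have sol: "path_solution A f e x0 x" using elim(1) by (simp add: e_def[abs_def] x_def[abs_def])
      have f_le: "AE u in path_measure e. 0 \<le> u \<longrightarrow> norm (f (e u) (x u)) \<le> h (e u) * norm (x u)"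
        using AE_path_measure_compose[OF e gh]
      proof eventually_elim
        case u: (elim u)
        show ?case
        proof
          assume "0 \<le> u"
          from this u time_change_path_nonneg[OF e, of u] have "norm (g (e u)) = h (e u)" by simp
          moreover have "norm (f (e u) (x u)) \<le> norm (g (e u)) * norm (x u)"
            using elim(3) \<open>0 \<le> u\<close> by (simp add: e_def x_def)
          ultimately show "norm (f (e u) (x u)) \<le> h (e u) * norm (x u)" by simp
        qed
      qed
      have "N (x t) \<le> N x0 * exp (C * (LINT v|lborel. h v)) * exp (- l * t)"
        using l h0 C N_ge N_le N_add N_step e sol h f_le t by (rule path_solution_decay)
      also have "\<dots> \<le> (C * norm x0) * exp (C * (LINT v|lborel. h v)) * exp (- l * t)"
        by (intro mult_right_mono N_le) auto
      finally show "norm (X x0 t \<omega>) \<le> K * norm x0 * exp (- l * t)"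
        using N_ge[of "x t"] by (simp add: K_def x_def mult_ac)
    qed
  qed
  then show ?thesis
    by (intro stable_if_uniform_exponential_bound[OF assms(1) meas l]) (auto simp: K_def C)
qed

end
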